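(* Let $\mathcal E$ be a finite set of entities, $\mathcal R$ a finite set of relations, and let $\mathcal W\subseteq\mathcal E\times\mathcal R\times\mathcal E$ be any truth assignment (the set of true triples, of which there are $|\mathcal W|$; all other triples are false). Then there exists a SimplE$^+$ model with embedding vectors of size $k=\min(|\mathcal E||\mathcal R|+1,\ |\mathcal W|+1)$ that represents the assignment. That is, there are vectors $\mathbf e^+,\mathbf e^-\in\mathbb R^k$ with all entries non-negative for each $e\in\mathcal E$, and vectors $\mathbf r^+,\mathbf r^-\in\mathbb R^k$ for each $r\in\mathcal R$, such that $\mu(\mathbf h,\mathbf r,\mathbf t)>1/2$ for every $(h,r,t)\in\mathcal W$ and $\mu(\mathbf h,\mathbf r,\mathbf t)<1/2$ for every $(h,r,t)\in(\mathcal E\times\mathcal R\times\mathcal E)\setminus\mathcal W$.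
   Context: For vectors $\mathbf x,\mathbf y,\mathbf z\in\mathbb R^k$, write $\langle \mathbf x,\mathbf y,\mathbf z\rangle=\sum_{\ell=1}^k x_\ell y_\ell z_\ell$. In the SimplE model with embedding vectors of size $k$, each entity $e$ has an embedding $\mathbf e=[\mathbf e^+,\mathbf e^-]$, where $\mathbf e^+\in\mathbb R^k$ is its embedding as a head and $\mathbf e^-\in\mathbb R^k$ its embedding as a tail, and each relation $r$ has an embedding $\mathbf r=[\mathbf r^+,\mathbf r^-]$, where $\mathbf r^+\in\mathbb R^k$ is the forward embedding and $\mathbf r^-\in\mathbb R^k$ the embedding of its inverse. The probability assigned to a triple (head $h$, relation $r$, tail $t$) is $$\mu(\mathbf h,\mathbf r,\mathbf t)=\sigma\left(\tfrac12\left(\langle\mathbf h^+,\mathbf r^+,\mathbf t^-\rangle+\langle\mathbf t^+,\mathbf r^-,\mathbf h^-\rangle\right)\right),\qquad \sigma(x)=\frac1{1+e^{-x}}.$$ SimplE$^+$ is SimplE with the restriction that all entity embeddings are element-wise non-negative: $\mathbf e^+\ge0$ and $\mathbf e^-\ge 0$ for every entity $e$ (relation embeddings are unrestricted). *)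

theory Defs
  imports Complex_Main "Jordan_Normal_Form.Matrix"
begin

definition triple_prod :: "real vec \<Rightarrow> real vec \<Rightarrow> real vec \<Rightarrow> real" where
  "triple_prod x y z = (\<Sum>l<dim_vec x. x $ l * y $ l * z $ l)"

definition sigmoid :: "real \<Rightarrow> real" where
  "sigmoid x = 1 / (1 + exp (- x))"

(* For an entity the components are (head embedding, tail embedding), written e = [e+, e-];
   for a relation they are (forward embedding, embedding of the inverse), r = [r+, r-]. *)
type_synonym embedding = "real vec \<times> real vec"

abbreviation pos_part :: "embedding \<Rightarrow> real vec" where "pos_part \<equiv> fst"
abbreviation neg_part :: "embedding \<Rightarrow> real vec" where "neg_part \<equiv> snd"

definition simple_prob :: "embedding \<Rightarrow> embedding \<Rightarrow> embedding \<Rightarrow> real" where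
  "simple_prob h r t =
     sigmoid (1 / 2 * (triple_prod (pos_part h) (pos_part r) (neg_part t)
                     + triple_prod (pos_part t) (neg_part r) (neg_part h)))"

definition simple_model ::
    "nat \<Rightarrow> 'e set \<Rightarrow> 'r set \<Rightarrow> ('e \<Rightarrow> embedding) \<Rightarrow> ('r \<Rightarrow> embedding) \<Rightarrow> bool" where
  "simple_model k E R ent rel \<longleftrightarrow>
     (\<forall>e\<in>E. ent e \<in> carrier_vec k \<times> carrier_vec k) \<and>
     (\<forall>r\<in>R. rel r \<in> carrier_vec k \<times> carrier_vec k)"

(* The order on vectors is the element-wise one. *)
definition simple_plus_model ::
    "nat \<Rightarrow> 'e set \<Rightarrow> 'r set \<Rightarrow> ('e \<Rightarrow> embedding) \<Rightarrow> ('r \<Rightarrow> embedding) \<Rightarrow> bool" where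
  "simple_plus_model k E R ent rel \<longleftrightarrow>
     simple_model k E R ent rel \<and>
     (\<forall>e\<in>E. 0\<^sub>v k \<le> pos_part (ent e) \<and> 0\<^sub>v k \<le> neg_part (ent e))"

definition represents ::
    "'e set \<Rightarrow> 'r set \<Rightarrow> ('e \<Rightarrow> embedding) \<Rightarrow> ('r \<Rightarrow> embedding) \<Rightarrow> ('e \<times> 'r \<times> 'e) set \<Rightarrow> bool" where
  "represents E R ent rel W \<longleftrightarrow>
     (\<forall>(h, r, t) \<in> W. simple_prob (ent h) (rel r) (ent t) > 1 / 2) \<and>
     (\<forall>(h, r, t) \<in> (E \<times> R \<times> E) - W. simple_prob (ent h) (rel r) (ent t) < 1 / 2)"

end

(* Each pair (h, r) that starts a true triple gets one coordinate, on which the product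
   h+ r+ t- is 2 if (h, r, t) is true and 0 for all other triples; a last coordinate
   contributes -1 to every triple, and all r- vanish. As (h, r, t) |-> (h, r) maps the set W
   of true triples onto the set of these pairs, there are at most |W| of them, and clearly at
   most |E| |R|. *)
theory Submission
  imports Defs
begin

lemma sigmoid_greater_half_iff: "sigmoid x > 1 / 2 \<longleftrightarrow> x > 0"
  unfolding sigmoid_def by (simp add: field_simps add_pos_pos)

lemma sigmoid_less_half_iff: "sigmoid x < 1 / 2 \<longleftrightarrow> x < 0"
  unfolding sigmoid_def by (simp add: field_simps add_pos_pos)

text \<open>The sum runs over the dimension of \<open>x\<close>, but the entries of
  \<open>0\<^sub>v n\<close> are known only below \<open>n\<close>; hence the bound.\<close>

lemma triple_prod_zero [simp]: "dim_vec x \<le> n \<Longrightarrow> triple_prod x (0\<^sub>v n) z = 0"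
  by (simp add: triple_prod_def)

text \<open>Index \<open>l < m\<close> is the coordinate of the pair \<open>g l\<close>; index
  \<open>m\<close> is the constant coordinate, on which \<open>g\<close> has no influence.\<close>

definition head_vec :: "nat \<Rightarrow> (nat \<Rightarrow> 'e \<times> 'r) \<Rightarrow> 'e \<Rightarrow> real vec" where
  "head_vec m g h = vec (m + 1) (\<lambda>l. of_bool (l = m \<or> fst (g l) = h))"

definition tail_vec ::
    "nat \<Rightarrow> (nat \<Rightarrow> 'e \<times> 'r) \<Rightarrow> ('e \<times> 'r \<times> 'e) set \<Rightarrow> 'e \<Rightarrow> real vec" where
  "tail_vec m g W t =
     vec (m + 1) (\<lambda>l. of_bool (l = m \<or> (fst (g l), snd (g l), t) \<in> W))"

text \<open>The 2 lets one matching coordinate outweigh the -1. The sign sits here because entity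
  entries must be non-negative.\<close>

definition rel_vec :: "nat \<Rightarrow> (nat \<Rightarrow> 'e \<times> 'r) \<Rightarrow> 'r \<Rightarrow> real vec" where
  "rel_vec m g r = vec (m + 1) (\<lambda>l. if l = m then - 1 else 2 * of_bool (snd (g l) = r))"

text \<open>At \<open>l < m\<close> the three factors test the head of \<open>g l\<close>, its
  relation, and whether \<open>t\<close> completes it to a true triple. Coordinate \<open>m\<close>
  gives 1 * (-1) * 1.\<close>

lemma triple_prod_indicator:
  "triple_prod (head_vec m g h) (rel_vec m g r) (tail_vec m g W t) =
     (\<Sum>l<m. 2 * of_bool (g l = (h, r) \<and> (h, r, t) \<in> W)) - 1"
proof -
  have "(\<Sum>l<m. head_vec m g h $ l * rel_vec m g r $ l * tail_vec m g W t $ l) =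
      (\<Sum>l<m. 2 * of_bool (g l = (h, r) \<and> (h, r, t) \<in> W))"
    by (rule sum.cong) (auto simp: head_vec_def rel_vec_def tail_vec_def prod_eq_iff)
  then show ?thesis
    by (simp add: triple_prod_def) (simp add: head_vec_def rel_vec_def tail_vec_def)
qed

theorem theorem4:
  fixes E :: "'e set" and R :: "'r set" and W :: "('e \<times> 'r \<times> 'e) set"
  assumes "finite E" and "finite R" and "W \<subseteq> E \<times> R \<times> E"
  shows "\<exists>ent rel.
    simple_plus_model (min (card E * card R + 1) (card W + 1)) E R ent rel \<and>
    represents E R ent rel W"
proof -
  define P where "P = (\<lambda>(h, r, t). (h, r)) ` W"
  \<comment> \<open>The dimension is prescribed, so \<open>m\<close> may exceed
    \<open>card P\<close>.\<close>
  define m where "m = min (card E * card R) (card W)"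
  have "finite W"
    using assms by (meson finite_SigmaI finite_subset)
  have "P \<subseteq> E \<times> R"
    using assms(3) by (auto simp: P_def)
  then have "finite P" "card P \<le> card E * card R"
    using assms(1,2) card_mono[of "E \<times> R" P]
    by (auto simp: card_cartesian_product intro: finite_subset)
  moreover have "card P \<le> card W"
    unfolding P_def using \<open>finite W\<close> by (rule card_image_le)
  ultimately have "card P \<le> m"
    by (simp add: m_def)
  obtain g where "bij_betw g {0..<card P} P"
    using ex_bij_betw_nat_finite[OF \<open>finite P\<close>] by blast
  \<comment> \<open>Indices below \<open>card P\<close> already reach every pair; from there up to
    \<open>m\<close> the values of \<open>g\<close> are arbitrary and may repeat pairs.\<close>
  then have g: "\<exists>l<m. g l = (h, r)" if "(h, r, t) \<in> W" for h r t
    using that \<open>card P \<le> m\<close> by (force simp: P_def bij_betw_def)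
  let ?ent = "\<lambda>e. (head_vec m g e, tail_vec m g W e)"
  let ?rel = "\<lambda>r. (rel_vec m g r, 0\<^sub>v (m + 1))"
  have prob: "simple_prob (?ent h) (?rel r) (?ent t) =
      sigmoid (1 / 2 * ((\<Sum>l<m. 2 * of_bool (g l = (h, r) \<and> (h, r, t) \<in> W)) - 1))" for h r t
  proof -
    have "dim_vec (head_vec m g t) \<le> m + 1"
      by (simp add: head_vec_def)
    then show ?thesis
      by (simp only: simple_prob_def fst_conv snd_conv triple_prod_indicator triple_prod_zero
        add_0_right)
  qed
  have "simple_prob (?ent h) (?rel r) (?ent t) > 1 / 2" if "(h, r, t) \<in> W" for h r t
  proof -
    obtain l where "l < m" "g l = (h, r)"
      using g[OF \<open>(h, r, t) \<in> W\<close>] by blast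
    \<comment> \<open>One match suffices: repeated pairs only add non-negative terms.\<close>
    then have "(2::real) \<le> (\<Sum>l<m. 2 * of_bool (g l = (h, r) \<and> (h, r, t) \<in> W))"
      using that
        member_le_sum[of l "{..<m}" "\<lambda>l. 2 * of_bool (g l = (h, r) \<and> (h, r, t) \<in> W) :: real"]
      by simp
    moreover have "0 < 1 / 2 * (s - 1)" if "2 \<le> s" for s :: real
      using that by simp
    ultimately show ?thesis
      unfolding prob sigmoid_greater_half_iff by blast
  qed
  \<comment> \<open>Every summand vanishes, whatever \<open>g\<close> is, so \<open>sigmoid\<close>
    is taken at -1/2.\<close>
  moreover have "simple_prob (?ent h) (?rel r) (?ent t) < 1 / 2" if "(h, r, t) \<notin> W" for h r t
    unfolding prob sigmoid_less_half_iff using that by simp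
  ultimately have "represents E R ?ent ?rel W"
    unfolding represents_def by blast
  moreover have "simple_plus_model (m + 1) E R ?ent ?rel"
    by (auto simp: simple_plus_model_def simple_model_def less_eq_vec_def
      head_vec_def tail_vec_def rel_vec_def)
  moreover have "min (card E * card R + 1) (card W + 1) = m + 1"
    by (simp add: m_def)
  ultimately show ?thesis
    by metis
qed

end
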